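(* For every tournament $T$ on $n$ vertices, $$c(T,5) \le \frac{3}{4}\binom{n}{5} + \frac{1}{4}\binom{n}{2}\left(\frac{n-2}{2}\right)^2,$$ where $c(T,5)$ is the number of directed 5-cycles in $T$.
   Context: A tournament on $n$ vertices (an $n$-tournament) is a directed graph $T=(V,E)$ with $|V|=n$, without loops, such that for every pair of distinct vertices $u,v$ exactly one of $(u,v),(v,u)$ lies in $E$. The quantity $c(T,k)$ is the number of directed $k$-cycles of $T$, counted as subgraphs (i.e. cyclic rotations of the same vertex sequence give the same cycle). *)

theory Defs
  imports Complex_Main "Graph_Theory.Pair_Digraph"
begin

locale tournament = pair_digraph T for T :: "'a pair_pre_digraph" +
  assumes exactly_one_arc:
    "\<lbrakk>u \<in> pverts T; v \<in> pverts T; u \<noteq> v\<rbrakk> \<Longrightarrow> ((u, v) \<in> parcs T) \<noteq> ((v, u) \<in> parcs T)"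

text \<open>
  The library's cycles are lists of arcs with a distinguished starting point. Passing to the
  subgraph with the same vertices and arcs identifies exactly the rotations of such a list.
\<close>

definition directed_cycles :: "'a pair_pre_digraph \<Rightarrow> nat \<Rightarrow> 'a pair_pre_digraph set" where
  "directed_cycles T k =
    {\<lparr>pverts = fst ` set p, parcs = set p\<rparr> | p. pre_digraph.cycle (with_proj T) p \<and> length p = k}"

definition cycle_count :: "'a pair_pre_digraph \<Rightarrow> nat \<Rightarrow> nat" where
  "cycle_count T k = card (directed_cycles T k)"

end

theory Submission
  imports Defs "HOL-Analysis.Convex"
begin

text \<open>
  Encode \<open>T\<close> by the skew matrix \<open>M\<close> with entries 1, -1 off the diagonal, so that \<open>(1 + M u v) / 2\<close> is the
  indicator of an arc. Expand the product of the five indicators around a closed 5-walk and sum over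
  all tuples of distinct vertices: reversing the walk kills the odd terms, swapping the ends of an
  edge kills the products of two disjoint edges, and what remains is the main term
  \<open>3/4 (n choose 5)\<close> plus the sums of \<open>M b c * M c d\<close> and of \<open>M a b * M b c * M c d * M d e\<close>.

  Fixing \<open>b\<close> and \<open>d\<close>, these become polynomials in the scores \<open>s = M 1\<close> and the entries of
  \<open>M M\<^sup>T\<close>. Completing the square in \<open>(M M\<^sup>T) b d\<close> leaves only \<open>|M s|\<^sup>2\<close> to be bounded by a
  multiple of \<open>|s|\<^sup>2\<close>. The nonzero singular values of a skew matrix have even multiplicity, so the
  squared operator norm is at most half of the squared Frobenius norm, which suffices for
  \<open>n \<ge> 6\<close>. For \<open>n = 5\<close> a Hamiltonian cycle forces all scores into \<open>[-2, 2]\<close>, and that suffices too.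
\<close>

section \<open>Sums over ordered 5-tuples of distinct vertices\<close>

definition distinct_tuples :: "'a set \<Rightarrow> ('a \<times> 'a \<times> 'a \<times> 'a \<times> 'a) set" where
  "distinct_tuples V = {(a, b, c, d, e). {a, b, c, d, e} \<subseteq> V \<and> distinct [a, b, c, d, e]}"

lemma finite_distinct_tuples: "finite V \<Longrightarrow> finite (distinct_tuples V)"
  by (rule finite_subset[of _ "V \<times> V \<times> V \<times> V \<times> V"]) (auto simp: distinct_tuples_def)

text \<open>The tuple is read as a path \<open>a\<close>, \<open>b\<close>, \<open>c\<close>,
  \<open>d\<close>, \<open>e\<close>. With the ends \<open>a\<close> and \<open>e\<close> innermost
  and the middle \<open>c\<close> next, what remains is a function of the pair \<open>b\<close>,
  \<open>d\<close> that the estimates keep fixed.\<close>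

lemma sum_distinct_tuples:
  fixes g :: "'a \<Rightarrow> 'a \<Rightarrow> 'a \<Rightarrow> 'a \<Rightarrow> 'a \<Rightarrow> 'b :: comm_monoid_add"
  assumes "finite V"
  shows "(\<Sum>(a, b, c, d, e)\<in>distinct_tuples V. g a b c d e) =
    (\<Sum>b\<in>V. \<Sum>d\<in>V - {b}. \<Sum>c\<in>V - {b, d}. \<Sum>a\<in>V - {b, c, d}. \<Sum>e\<in>V - {a, b, c, d}. g a b c d e)"
  (is "?l = ?r")
proof -
  have "?r = (\<Sum>(b, d, c, a, e)\<in>(SIGMA b:V. SIGMA d:V - {b}. SIGMA c:V - {b, d}.
      SIGMA a:V - {b, c, d}. V - {a, b, c, d}). g a b c d e)"
    using assms by (simp add: sum.Sigma)
  also have "\<dots> = ?l"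
    by (rule sum.reindex_bij_witness[of _ "\<lambda>(a, b, c, d, e). (b, d, c, a, e)"
          "\<lambda>(b, d, c, a, e). (a, b, c, d, e)"]) (auto simp: distinct_tuples_def)
  finally show ?thesis by simp
qed

text \<open>Symmetries for the expansion of the cycle indicator: rotation moves a term along the
  closed walk, the reversal below turns all five arcs, and the swap turns only the arc between
  \<open>a\<close> and \<open>b\<close>.\<close>

lemma sum_distinct_tuples_rotate:
  "(\<Sum>(a, b, c, d, e)\<in>distinct_tuples V. g b c d e a) = (\<Sum>(a, b, c, d, e)\<in>distinct_tuples V. g a b c d e)"
  by (rule sum.reindex_bij_witness[of _ "\<lambda>(b, c, d, e, a). (a, b, c, d, e)"
        "\<lambda>(a, b, c, d, e). (b, c, d, e, a)"]) (auto simp: distinct_tuples_def)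

lemma sum_distinct_tuples_reverse:
  "(\<Sum>(a, b, c, d, e)\<in>distinct_tuples V. g e d c b a) = (\<Sum>(a, b, c, d, e)\<in>distinct_tuples V. g a b c d e)"
  by (rule sum.reindex_bij_witness[of _ "\<lambda>(a, b, c, d, e). (e, d, c, b, a)"
        "\<lambda>(a, b, c, d, e). (e, d, c, b, a)"]) (auto simp: distinct_tuples_def)

lemma sum_distinct_tuples_swap:
  "(\<Sum>(a, b, c, d, e)\<in>distinct_tuples V. g b a c d e) = (\<Sum>(a, b, c, d, e)\<in>distinct_tuples V. g a b c d e)"
  by (rule sum.reindex_bij_witness[of _ "\<lambda>(a, b, c, d, e). (b, a, c, d, e)"
        "\<lambda>(a, b, c, d, e). (b, a, c, d, e)"]) (auto simp: distinct_tuples_def)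

lemma of_nat_5_mult_choose:
  "real (n choose 5) * 120 = real n * (real n - 1) * (real n - 2) * (real n - 3) * (real n - 4)"
  by (simp add: binomial_gbinomial gbinomial_prod_rev fact_numeral numeral_eq_Suc field_simps)

lemma of_nat_2_mult_choose: "real (n choose 2) * 2 = real n * (real n - 1)"
  by (simp add: binomial_gbinomial gbinomial_prod_rev fact_numeral numeral_eq_Suc field_simps)

section \<open>Skew matrices with off-diagonal entries of square 1\<close>

locale tournament_matrix =
  fixes V :: "'a set" and M :: "'a \<Rightarrow> 'a \<Rightarrow> real"
  assumes fin: "finite V"
    and skew: "M u v = - M v u"
    and unit: "\<lbrakk>u \<in> V; v \<in> V; u \<noteq> v\<rbrakk> \<Longrightarrow> (M u v)\<^sup>2 = 1"
begin

text \<open>Out-degree minus in-degree when \<open>M\<close> comes from a tournament.\<close>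

definition score :: "'a \<Rightarrow> real" where
  "score b = (\<Sum>c\<in>V. M b c)"

definition gram :: "'a \<Rightarrow> 'a \<Rightarrow> real" where
  "gram b d = (\<Sum>c\<in>V. M b c * M d c)"

definition score2 :: "'a \<Rightarrow> real" where
  "score2 c = (\<Sum>b\<in>V. M c b * score b)"

lemma diag [simp]: "M u u = 0"
  using skew[of u u] by simp

lemma unit_mult_self: "\<lbrakk>u \<in> V; v \<in> V; u \<noteq> v\<rbrakk> \<Longrightarrow> M u v * M u v = 1"
  using unit[of u v] by (simp add: power2_eq_square)

section \<open>Summing over the ends and the middle of a path\<close>

lemma sum_remove2:
  fixes g :: "'a \<Rightarrow> real"
  assumes "b \<in> V" "d \<in> V" "b \<noteq> d"
  shows "(\<Sum>c\<in>V - {b, d}. g c) = (\<Sum>c\<in>V. g c) - g b - g d"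
  using assms fin by (subst sum_diff) auto

lemma sum_remove3:
  fixes g :: "'a \<Rightarrow> real"
  assumes "b \<in> V" "c \<in> V" "d \<in> V" "b \<noteq> d" "c \<noteq> b" "c \<noteq> d"
  shows "(\<Sum>a\<in>V - {b, c, d}. g a) = (\<Sum>a\<in>V. g a) - g b - g c - g d"
  using assms fin by (subst sum_diff) auto

lemma sum_remove4:
  fixes g :: "'a \<Rightarrow> real"
  assumes "b \<in> V" "c \<in> V" "d \<in> V" "a \<in> V" "distinct [a, b, c, d]"
  shows "(\<Sum>a\<in>V - {a, b, c, d}. g a) = (\<Sum>a\<in>V. g a) - g a - g b - g c - g d"
  using assms fin by (subst sum_diff) auto

text \<open>If \<open>a = e\<close> were allowed, the sum would factor into the product in the first
  summand. Removing the terms with \<open>a = e\<close> adds the part of \<open>gram b d\<close>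
  outside \<open>{b, c, d}\<close>; its terms at \<open>b\<close> and \<open>d\<close> vanish with
  the diagonal of \<open>M\<close>, so only the one at \<open>c\<close> is subtracted.\<close>

lemma path_sum_ends:
  assumes "b \<in> V" "c \<in> V" "d \<in> V" "b \<noteq> d" "c \<noteq> b" "c \<noteq> d"
  shows "(\<Sum>a\<in>V - {b, c, d}. \<Sum>e\<in>V - {a, b, c, d}. M a b * M d e) =
    - (score b - M b c - M b d) * (score d - M d c + M b d) + gram b d - M b c * M d c"
proof -
  have "(\<Sum>a\<in>V - {b, c, d}. \<Sum>e\<in>V - {a, b, c, d}. M a b * M d e) =
      (\<Sum>a\<in>V - {b, c, d}. - (score d - M d c + M b d) * M b a + M b a * M d a)"
  proof (rule sum.cong[OF refl])
    fix a assume "a \<in> V - {b, c, d}"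
    with assms show "(\<Sum>e\<in>V - {a, b, c, d}. M a b * M d e) =
        - (score d - M d c + M b d) * M b a + M b a * M d a"
      by (subst sum_remove4)
        (auto simp: skew[of a b] skew[of d b] score_def algebra_simps sum_negf simp flip: sum_distrib_left)
  qed
  also have "\<dots> = - (score d - M d c + M b d) * (score b - M b c - M b d) + gram b d - M b c * M d c"
    by (simp only: sum.distrib sum_remove3[OF assms] flip: sum_distrib_left)
       (simp add: score_def gram_def algebra_simps skew[of d b])
  finally show ?thesis by (simp add: algebra_simps)
qed

text \<open>\<open>X\<close> and \<open>Y\<close> are the sums of the rows \<open>b\<close> and
  \<open>d\<close> outside \<open>{b, d}\<close>. Since the entries square to 1, the summand for
  \<open>c\<close> is a combination of \<open>M b c * M d c\<close>, \<open>M b c\<close>,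
  \<open>M d c\<close> and 1, whose sums are \<open>gram b d\<close>, \<open>X\<close>,
  \<open>Y\<close> and \<open>card V - 2\<close>.\<close>

lemma path_sum:
  assumes "b \<in> V" "d \<in> V" "b \<noteq> d"
  defines "X \<equiv> score b - M b d" and "Y \<equiv> score d + M b d"
  shows "(\<Sum>c\<in>V - {b, d}. \<Sum>a\<in>V - {b, c, d}. \<Sum>e\<in>V - {a, b, c, d}. M a b * M b c * M c d * M d e) =
    gram b d * X * Y - X\<^sup>2 - Y\<^sup>2 - (gram b d)\<^sup>2 + 2 * (real (card V) - 2)"
proof -
  have "(\<Sum>c\<in>V - {b, d}. \<Sum>a\<in>V - {b, c, d}. \<Sum>e\<in>V - {a, b, c, d}. M a b * M b c * M c d * M d e) =
    (\<Sum>c\<in>V - {b, d}. (X * Y - gram b d) * (M b c * M d c) + (- X) * M b c + (- Y) * M d c + 2)"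
  proof (rule sum.cong[OF refl])
    fix c assume c: "c \<in> V - {b, d}"
    then have p: "M b c * M b c = 1" and q: "M d c * M d c = 1"
      using assms by (auto intro!: unit_mult_self)
    have "(\<Sum>a\<in>V - {b, c, d}. \<Sum>e\<in>V - {a, b, c, d}. M a b * M b c * M c d * M d e) =
       - (M b c * M d c) * (\<Sum>a\<in>V - {b, c, d}. \<Sum>e\<in>V - {a, b, c, d}. M a b * M d e)"
      by (simp add: sum_distrib_left skew[of c d] algebra_simps)
    also have "\<dots> = - (M b c * M d c) * (- (X - M b c) * (Y - M d c) + gram b d - M b c * M d c)"
      using c assms by (subst path_sum_ends) (auto simp: X_def Y_def algebra_simps)
    \<comment> \<open>The constant 2 is the square of \<open>M b c * M d c\<close> counted twice:
      from the product of the end sums and from the correction for \<open>a = e\<close>.\<close>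
    also have "\<dots> = (X * Y - gram b d) * (M b c * M d c) + (- X) * M b c + (- Y) * M d c + 2"
      using p q by algebra
    finally show "(\<Sum>a\<in>V - {b, c, d}. \<Sum>e\<in>V - {a, b, c, d}. M a b * M b c * M c d * M d e) = \<dots>" .
  qed
  also have "\<dots> = (X * Y - gram b d) * gram b d - X * X - Y * Y + 2 * (real (card V) - 2)"
    by (simp only: sum.distrib sum_remove2[OF assms(1-3)] flip: sum_distrib_left)
       (simp add: X_def Y_def score_def gram_def algebra_simps skew[of d b])
  finally show ?thesis by (simp add: algebra_simps power2_eq_square)
qed

lemma card_remove: "A \<subseteq> V \<Longrightarrow> real (card (V - A)) = real (card V) - real (card A)"
  using fin by (simp add: card_Diff_subset finite_subset card_mono of_nat_diff)

lemma sum_const_remove2: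
  assumes "b \<in> V" "d \<in> V" "b \<noteq> d"
  shows "(\<Sum>c\<in>V - {b, d}. k :: real) = (real (card V) - 2) * k"
  using assms by (simp add: card_remove del: card_Diff_insert)

lemma sum_const_remove3:
  assumes "b \<in> V" "c \<in> V" "d \<in> V" "b \<noteq> d" "c \<noteq> b" "c \<noteq> d"
  shows "(\<Sum>a\<in>V - {b, c, d}. k :: real) = (real (card V) - 3) * k"
  using assms by (simp add: card_remove del: card_Diff_insert)

lemma sum_const_remove4:
  assumes "b \<in> V" "c \<in> V" "d \<in> V" "a \<in> V" "distinct [a, b, c, d]"
  shows "(\<Sum>e\<in>V - {a, b, c, d}. k :: real) = (real (card V) - 4) * k"
  using assms by (simp add: card_remove del: card_Diff_insert)

text \<open>The ends \<open>a\<close> and \<open>e\<close> do not occur in the summand and only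
  contribute the number of their choices. The sign comes from
  \<open>M c d = - M d c\<close>.\<close>

lemma cherry_sum:
  assumes "b \<in> V" "d \<in> V" "b \<noteq> d"
  shows "(\<Sum>c\<in>V - {b, d}. \<Sum>a\<in>V - {b, c, d}. \<Sum>e\<in>V - {a, b, c, d}. M b c * M c d) =
    - (real (card V) - 3) * (real (card V) - 4) * gram b d"
proof -
  have "(\<Sum>c\<in>V - {b, d}. \<Sum>a\<in>V - {b, c, d}. \<Sum>e\<in>V - {a, b, c, d}. M b c * M c d) =
    (\<Sum>c\<in>V - {b, d}. (- (real (card V) - 3) * (real (card V) - 4)) * (M b c * M d c))"
  proof (rule sum.cong[OF refl])
    fix c assume c: "c \<in> V - {b, d}"
    have "(\<Sum>a\<in>V - {b, c, d}. \<Sum>e\<in>V - {a, b, c, d}. M b c * M c d) =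
       (\<Sum>a\<in>V - {b, c, d}. (real (card V) - 4) * (M b c * M c d))"
      using c assms by (intro sum.cong refl sum_const_remove4) auto
    also have "\<dots> = (real (card V) - 3) * ((real (card V) - 4) * (M b c * M c d))"
      using c assms by (intro sum_const_remove3) auto
    finally show "(\<Sum>a\<in>V - {b, c, d}. \<Sum>e\<in>V - {a, b, c, d}. M b c * M c d) =
       (- (real (card V) - 3) * (real (card V) - 4)) * (M b c * M d c)"
      by (simp add: skew[of c d] algebra_simps)
  qed
  also have "\<dots> = - (real (card V) - 3) * (real (card V) - 4) * gram b d"
    by (simp only: sum_remove2[OF assms] flip: sum_distrib_left) (simp add: gram_def)
  finally show ?thesis .
qed

text \<open>Over the reals the falling factorial is correct for every size of \<open>V\<close>:
  below five vertices one factor is zero.\<close>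

lemma card_distinct_tuples:
  "real (card (distinct_tuples V)) =
    real (card V) * (real (card V) - 1) * (real (card V) - 2) * (real (card V) - 3) * (real (card V) - 4)"
proof -
  have "real (card (distinct_tuples V)) = (\<Sum>(a, b, c, d, e)\<in>distinct_tuples V. 1)"
    by (simp add: case_prod_unfold)
  also have "\<dots> = (\<Sum>b\<in>V. \<Sum>d\<in>V - {b}. \<Sum>c\<in>V - {b, d}. \<Sum>a\<in>V - {b, c, d}. \<Sum>e\<in>V - {a, b, c, d}. 1)"
    by (rule sum_distinct_tuples[OF fin])
  also have "\<dots> = (\<Sum>b\<in>V. \<Sum>d\<in>V - {b}. \<Sum>c\<in>V - {b, d}. \<Sum>a\<in>V - {b, c, d}. (real (card V) - 4) * 1)"
    by (intro sum.cong refl sum_const_remove4) auto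
  also have "\<dots> = (\<Sum>b\<in>V. \<Sum>d\<in>V - {b}. \<Sum>c\<in>V - {b, d}. (real (card V) - 3) * ((real (card V) - 4) * 1))"
    by (intro sum.cong refl sum_const_remove3) auto
  also have "\<dots> = (\<Sum>b\<in>V. \<Sum>d\<in>V - {b}. (real (card V) - 2) * ((real (card V) - 3) * ((real (card V) - 4) * 1)))"
    by (intro sum.cong refl sum_const_remove2) auto
  also have "\<dots> = real (card V) * (real (card V) - 1) * (real (card V) - 2) * (real (card V) - 3) * (real (card V) - 4)"
    by (simp add: card_remove del: card_Diff_insert)
  finally show ?thesis .
qed

section \<open>Quadratic sums in scores and Gram entries\<close>

lemma sum_score: "(\<Sum>b\<in>V. score b) = 0"
proof -
  have "(\<Sum>b\<in>V. score b) = (\<Sum>c\<in>V. \<Sum>b\<in>V. M b c)"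
    unfolding score_def by (rule sum.swap)
  also have "\<dots> = (\<Sum>c\<in>V. \<Sum>b\<in>V. - M c b)"
    by (intro sum.cong refl) (rule skew)
  also have "\<dots> = - (\<Sum>b\<in>V. score b)"
    by (simp add: sum_negf score_def)
  finally show ?thesis by simp
qed

text \<open>For the score vector \<open>s\<close>, \<open>S\<close> is the squared norm of
  \<open>s\<close> and \<open>R\<close> that of \<open>M s\<close>.\<close>

abbreviation S :: real where "S \<equiv> (\<Sum>b\<in>V. (score b)\<^sup>2)"
abbreviation R :: real where "R \<equiv> (\<Sum>b\<in>V. (score2 b)\<^sup>2)"

text \<open>The quadratic form of the Gram matrix at \<open>x\<close> is the squared norm of the
  transpose of \<open>M\<close> applied to \<open>x\<close>, and that transpose is
  \<open>-M\<close>. The all-ones vector gives \<open>S\<close>, the score vector gives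
  \<open>R\<close>.\<close>

lemma sum_gram_weighted:
  "(\<Sum>b\<in>V. \<Sum>d\<in>V. gram b d * (x b * x d)) = (\<Sum>c\<in>V. (\<Sum>b\<in>V. M c b * x b)\<^sup>2)"
proof -
  have "(\<Sum>b\<in>V. \<Sum>d\<in>V. gram b d * (x b * x d)) = (\<Sum>b\<in>V. \<Sum>d\<in>V. \<Sum>c\<in>V. (M c b * x b) * (M c d * x d))"
    unfolding gram_def sum_distrib_right
    by (intro sum.cong refl) (subst (2) skew, subst (1) skew, simp)
  also have "\<dots> = (\<Sum>b\<in>V. \<Sum>c\<in>V. \<Sum>d\<in>V. (M c b * x b) * (M c d * x d))"
    by (intro sum.cong refl sum.swap)
  also have "\<dots> = (\<Sum>c\<in>V. \<Sum>b\<in>V. \<Sum>d\<in>V. (M c b * x b) * (M c d * x d))"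
    by (rule sum.swap)
  also have "\<dots> = (\<Sum>c\<in>V. (\<Sum>b\<in>V. M c b * x b)\<^sup>2)"
    by (simp add: power2_eq_square sum_product)
  finally show ?thesis .
qed

lemma sum_gram: "(\<Sum>b\<in>V. \<Sum>d\<in>V. gram b d) = S"
  using sum_gram_weighted[of "\<lambda>_. 1"] by (simp add: score_def)

lemma sum_gram_score: "(\<Sum>b\<in>V. \<Sum>d\<in>V. gram b d * (score b * score d)) = R"
  by (simp add: sum_gram_weighted score2_def)

lemma gram_diag: "b \<in> V \<Longrightarrow> gram b b = real (card V) - 1"
proof -
  assume b: "b \<in> V"
  have "gram b b = (\<Sum>c\<in>V - {b}. M b c * M b c)"
    unfolding gram_def using fin b by (simp add: sum_diff1)
  also have "\<dots> = (\<Sum>c\<in>V - {b}. 1)"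
    using b by (intro sum.cong refl) (auto intro: unit_mult_self)
  also have "\<dots> = real (card V) - 1"
    using b by (simp add: card_remove del: card_Diff_insert)
  finally show ?thesis .
qed

text \<open>The cross terms add up to a multiple of the square of the total score, which is
  zero.\<close>

lemma sum_score_diff_squares: "(\<Sum>b\<in>V. \<Sum>d\<in>V. (score b - score d)\<^sup>2) = 2 * real (card V) * S"
  by (simp add: power2_diff sum.distrib sum_subtractf sum_score mult.assoc flip: sum_distrib_left sum_distrib_right)

text \<open>
  As \<open>M\<close> is skew, \<open>y = M s\<close> is orthogonal to \<open>s\<close>, and \<open>2 |y|\<^sup>2\<close> is the Frobenius product of \<open>M\<close> with
  \<open>y s\<^sup>T - s y\<^sup>T\<close>, a matrix of squared norm \<open>2 |y|\<^sup>2 |s|\<^sup>2\<close>. Apply Cauchy--Schwarz.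
\<close>

lemma R_le: "R \<le> real (card V) * (real (card V) - 1) / 2 * S"
proof -
  let ?n = "real (card V)"
  let ?D = "\<lambda>i j. score2 i * score j - score i * score2 j"
  have orth: "(\<Sum>i\<in>V. score2 i * score i) = 0"
  proof -
    have "(\<Sum>i\<in>V. score2 i * score i) = (\<Sum>i\<in>V. \<Sum>j\<in>V. M i j * score j * score i)"
      by (simp add: score2_def sum_distrib_right)
    also have "\<dots> = (\<Sum>j\<in>V. \<Sum>i\<in>V. M i j * score j * score i)"
      by (rule sum.swap)
    also have "\<dots> = (\<Sum>j\<in>V. \<Sum>i\<in>V. - (M j i * score i * score j))"
      by (intro sum.cong refl) (subst skew, simp)
    also have "\<dots> = - (\<Sum>i\<in>V. score2 i * score i)"
      by (simp add: score2_def sum_distrib_right sum_negf)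
    finally show ?thesis by simp
  qed
  have half: "(\<Sum>i\<in>V. \<Sum>j\<in>V. M i j * (score2 i * score j)) = R"
    by (simp add: score2_def[of _] power2_eq_square sum_distrib_left mult_ac)
  have "(\<Sum>i\<in>V. \<Sum>j\<in>V. M i j * (score i * score2 j)) = (\<Sum>j\<in>V. \<Sum>i\<in>V. M i j * (score i * score2 j))"
    by (rule sum.swap)
  also have "\<dots> = (\<Sum>j\<in>V. \<Sum>i\<in>V. - (M j i * (score2 j * score i)))"
    by (intro sum.cong refl) (subst skew, simp)
  finally have half': "(\<Sum>i\<in>V. \<Sum>j\<in>V. M i j * (score i * score2 j)) = - R"
    by (simp add: sum_negf half)
  have inner: "(\<Sum>i\<in>V. \<Sum>j\<in>V. M i j * ?D i j) = 2 * R"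
    by (simp add: right_diff_distrib sum_subtractf half half')
  have normD: "(\<Sum>i\<in>V. \<Sum>j\<in>V. (?D i j)\<^sup>2) = 2 * R * S"
  proof -
    have "(\<Sum>i\<in>V. \<Sum>j\<in>V. (?D i j)\<^sup>2) =
      (\<Sum>i\<in>V. \<Sum>j\<in>V. (score2 i)\<^sup>2 * (score j)\<^sup>2 + (score i)\<^sup>2 * (score2 j)\<^sup>2
         - (2 * (score2 i * score i)) * (score2 j * score j))"
      by (intro sum.cong refl) algebra
    \<comment> \<open>The cross term is twice the square of the inner product of \<open>M s\<close>
      and \<open>s\<close>, which \<open>orth\<close> makes zero.\<close>
    also have "\<dots> = R * S + S * R - (\<Sum>i\<in>V. 2 * (score2 i * score i)) * (\<Sum>i\<in>V. score2 i * score i)"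
      by (simp only: sum_product sum.distrib sum_subtractf)
    finally show ?thesis by (simp add: orth)
  qed
  have normM: "(\<Sum>i\<in>V. \<Sum>j\<in>V. (M i j)\<^sup>2) = ?n * (?n - 1)"
    using gram_diag by (simp add: gram_def power2_eq_square)
  have "(\<Sum>(i, j)\<in>V \<times> V. M i j * ?D i j)\<^sup>2 \<le>
      (\<Sum>(i, j)\<in>V \<times> V. (M i j)\<^sup>2) * (\<Sum>(i, j)\<in>V \<times> V. (?D i j)\<^sup>2)"
    using Cauchy_Schwarz_ineq_sum[of "\<lambda>(i, j). M i j" "\<lambda>(i, j). ?D i j" "V \<times> V"]
    by (simp add: case_prod_unfold)
  then have "(2 * R)\<^sup>2 \<le> (?n * (?n - 1)) * (2 * R * S)"
    by (simp only: inner normD normM flip: sum.cartesian_product)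
  then have *: "R * R \<le> R * (?n * (?n - 1) / 2 * S)"
    by (simp add: power2_eq_square field_simps)
  have "0 \<le> R" by (intro sum_nonneg) simp
  show ?thesis
  proof (cases "R = 0")
    case True
    have "0 \<le> ?n * (?n - 1)" unfolding normM[symmetric] by (intro sum_nonneg) simp
    moreover have "0 \<le> S" by (intro sum_nonneg) simp
    ultimately show ?thesis using True by simp
  next
    case False
    with \<open>0 \<le> R\<close> * show ?thesis by (simp add: mult_le_cancel_left)
  qed
qed

section \<open>Upper bounds for the cherry and path sums\<close>

lemma sum_off_diag:
  fixes u :: "'a \<Rightarrow> 'a \<Rightarrow> real"
  shows "(\<Sum>b\<in>V. \<Sum>d\<in>V - {b}. u b d) = (\<Sum>b\<in>V. \<Sum>d\<in>V. u b d) - (\<Sum>b\<in>V. u b b)"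
  using fin by (simp add: sum_diff1 sum_subtractf)

text \<open>For each pair \<open>b\<close>, \<open>d\<close> the inner sums are bounded by
  \<open>u b d\<close>, which is linear in the Gram entry. Then \<open>u\<close> is summed over all
  pairs and its diagonal subtracted.\<close>

lemma path_cherry_sum_le:
  defines "n \<equiv> real (card V)"
  shows "(\<Sum>(a, b, c, d, e)\<in>distinct_tuples V. M b c * M c d + M a b * M b c * M c d * M d e)
    \<le> R - (n\<^sup>2 - 9 / 2 * n + 6) * S + n * (n - 1) * (n\<^sup>2 - 5 * n + 7)"
proof -
  \<comment> \<open>The added 1 comes from \<open>- m * m\<close> in the expansion of
    \<open>(x - m) * (y + m)\<close>, which is multiplied by the Gram entry.\<close>
  define K where "K = (n - 3) * (n - 4) + 1"
  define u where "u b d = - K * gram b d + gram b d * (score b * score d) + 1 / 4 * (score b - score d)\<^sup>2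
      - (score b)\<^sup>2 - (score d)\<^sup>2 + 2 * (M b d * score b) + 2 * (M d b * score d) + (2 * n - 6)" for b d
  have "(\<Sum>(a, b, c, d, e)\<in>distinct_tuples V. M b c * M c d + M a b * M b c * M c d * M d e) =
    (\<Sum>b\<in>V. \<Sum>d\<in>V - {b}. (\<Sum>c\<in>V - {b, d}. \<Sum>a\<in>V - {b, c, d}. \<Sum>e\<in>V - {a, b, c, d}. M b c * M c d)
      + (\<Sum>c\<in>V - {b, d}. \<Sum>a\<in>V - {b, c, d}. \<Sum>e\<in>V - {a, b, c, d}. M a b * M b c * M c d * M d e))"
    by (subst sum_distinct_tuples[OF fin]) (simp only: sum.distrib)
  also have "\<dots> \<le> (\<Sum>b\<in>V. \<Sum>d\<in>V - {b}. u b d)"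
  proof (intro sum_mono)
    fix b d assume "b \<in> V" "d \<in> V - {b}"
    then have bd: "b \<in> V" "d \<in> V" "b \<noteq> d" by auto
    define m f x y where "m = M b d" and "f = gram b d" and "x = score b" and "y = score d"
    have mm: "m * m = 1" using bd by (simp add: m_def unit_mult_self)
    \<comment> \<open>Completing the square in \<open>f\<close> removes its quadratic term, and
      \<open>m * m = 1\<close> removes \<open>m\<close> from the bound.\<close>
    have "0 \<le> (f - m * (x - y) / 2)\<^sup>2" by simp
    also have "\<dots> = f\<^sup>2 - f * m * (x - y) + (m * m) * (x - y)\<^sup>2 / 4"
      by (simp add: power2_eq_square field_simps)
    finally have ineq: "f * m * (x - y) - f\<^sup>2 \<le> (x - y)\<^sup>2 / 4" by (simp add: mm)
    have "- (n - 3) * (n - 4) * f + (f * (x - m) * (y + m) - (x - m)\<^sup>2 - (y + m)\<^sup>2 - f\<^sup>2 + 2 * (n - 2))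
      = (f * m * (x - y) - f\<^sup>2) - K * f + f * (x * y) - x\<^sup>2 - y\<^sup>2 + 2 * (m * x) - 2 * (m * y) + (2 * n - 6)"
      using mm unfolding K_def by algebra
    also have "\<dots> \<le> u b d"
      using ineq unfolding u_def m_def f_def x_def y_def skew[of d b] by simp
    finally show "(\<Sum>c\<in>V - {b, d}. \<Sum>a\<in>V - {b, c, d}. \<Sum>e\<in>V - {a, b, c, d}. M b c * M c d)
      + (\<Sum>c\<in>V - {b, d}. \<Sum>a\<in>V - {b, c, d}. \<Sum>e\<in>V - {a, b, c, d}. M a b * M b c * M c d * M d e) \<le> u b d"
      unfolding cherry_sum[OF bd] path_sum[OF bd] by (simp add: m_def f_def x_def y_def n_def)
  qed
  also have "\<dots> = (\<Sum>b\<in>V. \<Sum>d\<in>V. u b d) - (\<Sum>b\<in>V. u b b)"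
    by (rule sum_off_diag)
  also have "(\<Sum>b\<in>V. \<Sum>d\<in>V. u b d) = - K * S + R + n / 2 * S - 2 * n * S + 4 * S + n * n * (2 * n - 6)"
  proof -
    have a: "(\<Sum>b\<in>V. \<Sum>d\<in>V. M b d * score b) = S"
      by (simp add: score_def power2_eq_square flip: sum_distrib_right)
    then have b: "(\<Sum>b\<in>V. \<Sum>d\<in>V. M d b * score d) = S"
      by (subst sum.swap)
    have c: "(\<Sum>b\<in>V. \<Sum>d\<in>V. (score b)\<^sup>2) = n * S" "(\<Sum>b\<in>V. \<Sum>d\<in>V. (score d)\<^sup>2) = n * S"
      by (simp_all add: n_def sum_distrib_left)
    show ?thesis
      unfolding u_def
      by (simp only: sum.distrib sum_subtractf a b c sum_gram sum_gram_score sum_score_diff_squares flip: sum_distrib_left)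
        (simp add: n_def algebra_simps)
  qed
  also have "(\<Sum>b\<in>V. u b b) = (\<Sum>b\<in>V. (n - 3) * (score b)\<^sup>2 + (2 * n - 6 - K * (n - 1)))"
    by (intro sum.cong refl) (simp add: u_def gram_diag n_def power2_eq_square algebra_simps)
  also have "\<dots> = (n - 3) * S + n * (2 * n - 6 - K * (n - 1))"
    by (simp add: sum.distrib n_def flip: sum_distrib_left)
  finally show ?thesis
    by (rule order_trans) (simp add: K_def power2_eq_square algebra_simps)
qed

text \<open>The target exceeds the constant term of \<open>path_cherry_sum_le\<close> by
  \<open>n * (n - 1) * (n - 3)\<close>, so this is the room left for the terms in \<open>R\<close>
  and \<open>S\<close>.\<close>

lemma path_cherry_sum_le_card:
  defines "n \<equiv> real (card V)"
  assumes "card V \<ge> 6 \<or> card V = 5 \<and> S \<le> 20"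
  shows "(\<Sum>(a, b, c, d, e)\<in>distinct_tuples V. M b c * M c d + M a b * M b c * M c d * M d e)
    \<le> n * (n - 1) * (n - 2)\<^sup>2"
proof -
  have "R - (n\<^sup>2 - 9 / 2 * n + 6) * S \<le> n * (n - 1) * (n - 3)"
    using assms(2)
  proof
    assume "card V \<ge> 6"
    then have n: "n \<ge> 6" by (simp add: n_def)
    have "R \<le> n * (n - 1) / 2 * S" using R_le by (simp add: n_def)
    also have "\<dots> \<le> (n\<^sup>2 - 9 / 2 * n + 6) * S"
    proof (rule mult_right_mono)
      \<comment> \<open>Half of this product is the difference of the two coefficients of
        \<open>S\<close>; here six vertices enter.\<close>
      have "0 \<le> (n - 2) * (n - 6)" using n by simp
      then show "n * (n - 1) / 2 \<le> n\<^sup>2 - 9 / 2 * n + 6" by (simp add: power2_eq_square field_simps)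
    qed (simp add: sum_nonneg)
    finally have "R - (n\<^sup>2 - 9 / 2 * n + 6) * S \<le> 0" by simp
    also have "0 \<le> n * (n - 1) * (n - 3)" using n by simp
    finally show ?thesis .
  next
    assume "card V = 5 \<and> S \<le> 20"
    \<comment> \<open>Here \<open>R\<close> is at most \<open>10 * S\<close> and the coefficient of
      \<open>S\<close> is 17/2, so the left side is at most 3/2 of \<open>S\<close>, hence at most
      30, while the right side is 40.\<close>
    then show ?thesis using R_le by (simp add: n_def)
  qed
  moreover have "n * (n - 1) * (n - 3) + n * (n - 1) * (n\<^sup>2 - 5 * n + 7) = n * (n - 1) * (n - 2)\<^sup>2"
    by algebra
  ultimately show ?thesis
    using path_cherry_sum_le by (simp add: n_def)
qed

section \<open>Expansion of the cycle indicator\<close>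

lemma cycle_indicator_sum:
  "32 * (\<Sum>(a, b, c, d, e)\<in>distinct_tuples V.
      (1 + M a b) / 2 * ((1 + M b c) / 2) * ((1 + M c d) / 2) * ((1 + M d e) / 2) * ((1 + M e a) / 2)) =
    real (card (distinct_tuples V)) +
    5 * (\<Sum>(a, b, c, d, e)\<in>distinct_tuples V. M b c * M c d + M a b * M b c * M c d * M d e)"
proof -
  \<comment> \<open>With the sum as a functional on five-argument functions, each symmetry is an
    equation to be instantiated with a monomial.\<close>
  define T :: "('a \<Rightarrow> 'a \<Rightarrow> 'a \<Rightarrow> 'a \<Rightarrow> 'a \<Rightarrow> real) \<Rightarrow> real"
    where "T g = (\<Sum>(a, b, c, d, e)\<in>distinct_tuples V. g a b c d e)" for g
  have rot: "T (\<lambda>a b c d e. g b c d e a) = T (\<lambda>a b c d e. g a b c d e)" for g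
    unfolding T_def by (rule sum_distinct_tuples_rotate)
  have rev: "T (\<lambda>a b c d e. g e d c b a) = T (\<lambda>a b c d e. g a b c d e)" for g
    unfolding T_def by (rule sum_distinct_tuples_reverse)
  have swap: "T (\<lambda>a b c d e. g b a c d e) = T (\<lambda>a b c d e. g a b c d e)" for g
    unfolding T_def by (rule sum_distinct_tuples_swap)
  have add: "T (\<lambda>a b c d e. g a b c d e + h a b c d e) = T g + T h" for g h
    unfolding T_def by (simp add: sum.distrib case_prod_unfold)
  have neg: "T (\<lambda>a b c d e. - g a b c d e) = - T g" for g
    unfolding T_def by (simp add: sum_negf case_prod_unfold)
  have scale: "T (\<lambda>a b c d e. k * g a b c d e) = k * T g" for g k
    unfolding T_def by (simp add: sum_distrib_left case_prod_unfold)
  have one: "T (\<lambda>a b c d e. 1) = real (card (distinct_tuples V))"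
    unfolding T_def by (simp add: case_prod_unfold)
  define P where "P = T (\<lambda>a b c d e. M b c * M c d)"
  define Q where "Q = T (\<lambda>a b c d e. M a b * M b c * M c d * M d e)"
  define C where "C = T (\<lambda>a b c d e.
    (1 + M a b) / 2 * ((1 + M b c) / 2) * ((1 + M c d) / 2) * ((1 + M d e) / 2) * ((1 + M e a) / 2))"
  have p2: "T (\<lambda>a b c d e. M c d * M d e) = P"
    using rot[of "\<lambda>a b c d e. M b c * M c d"] by (simp add: P_def)
  have p3: "T (\<lambda>a b c d e. M d e * M e a) = P"
    using rot[of "\<lambda>a b c d e. M c d * M d e"] p2 by simp
  have p4: "T (\<lambda>a b c d e. M e a * M a b) = P"
    using rot[of "\<lambda>a b c d e. M d e * M e a"] p3 by simp
  have p5: "T (\<lambda>a b c d e. M a b * M b c) = P"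
    using rot[of "\<lambda>a b c d e. M e a * M a b"] p4 by simp
  \<comment> \<open>Exchanging \<open>a\<close> and \<open>b\<close> negates the first factor and
    leaves the second one alone, so the sum equals its own negative.\<close>
  have "T (\<lambda>a b c d e. M a b * M c d) = T (\<lambda>a b c d e. M b a * M c d)"
    by (rule swap[symmetric])
  also have "\<dots> = T (\<lambda>a b c d e. - (M a b * M c d))"
    by (intro arg_cong[of _ _ T] ext) (subst skew, simp)
  finally have z1: "T (\<lambda>a b c d e. M a b * M c d) = 0"
    by (simp add: neg)
  have z2: "T (\<lambda>a b c d e. M b c * M d e) = 0"
    using rot[of "\<lambda>a b c d e. M a b * M c d"] z1 by simp
  have z3: "T (\<lambda>a b c d e. M c d * M e a) = 0"
    using rot[of "\<lambda>a b c d e. M b c * M d e"] z2 by simp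
  have z4: "T (\<lambda>a b c d e. M d e * M a b) = 0"
    using rot[of "\<lambda>a b c d e. M c d * M e a"] z3 by simp
  have z5: "T (\<lambda>a b c d e. M e a * M b c) = 0"
    using rot[of "\<lambda>a b c d e. M d e * M a b"] z4 by simp
  have q2: "T (\<lambda>a b c d e. M b c * M c d * M d e * M e a) = Q"
    using rot[of "\<lambda>a b c d e. M a b * M b c * M c d * M d e"] by (simp add: Q_def)
  have q3: "T (\<lambda>a b c d e. M c d * M d e * M e a * M a b) = Q"
    using rot[of "\<lambda>a b c d e. M b c * M c d * M d e * M e a"] q2 by simp
  have q4: "T (\<lambda>a b c d e. M d e * M e a * M a b * M b c) = Q"
    using rot[of "\<lambda>a b c d e. M c d * M d e * M e a * M a b"] q3 by simp
  have q5: "T (\<lambda>a b c d e. M e a * M a b * M b c * M c d) = Q"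
    using rot[of "\<lambda>a b c d e. M d e * M e a * M a b * M b c"] q4 by simp
  \<comment> \<open>Adding the reversed walk cancels the odd monomials and doubles the even ones.
    These are 1, five pairs of adjacent edges, five pairs of disjoint edges and five products of
    four edges; each group of five is one orbit under rotation.\<close>
  have "16 * (C + C) = 16 * (C + T (\<lambda>a b c d e.
    (1 + M e d) / 2 * ((1 + M d c) / 2) * ((1 + M c b) / 2) * ((1 + M b a) / 2) * ((1 + M a e) / 2)))"
    unfolding C_def by (subst (2) rev[symmetric]) simp
  also have "\<dots> = T (\<lambda>a b c d e. 16 * (
      (1 + M a b) / 2 * ((1 + M b c) / 2) * ((1 + M c d) / 2) * ((1 + M d e) / 2) * ((1 + M e a) / 2) +
      (1 + M e d) / 2 * ((1 + M d c) / 2) * ((1 + M c b) / 2) * ((1 + M b a) / 2) * ((1 + M a e) / 2)))"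
    unfolding C_def by (simp only: add scale)
  also have "\<dots> = T (\<lambda>a b c d e. 1
      + (M a b * M b c + M b c * M c d + M c d * M d e + M d e * M e a + M e a * M a b)
      + (M a b * M c d + M b c * M d e + M c d * M e a + M d e * M a b + M e a * M b c)
      + (M a b * M b c * M c d * M d e + M b c * M c d * M d e * M e a + M c d * M d e * M e a * M a b
         + M d e * M e a * M a b * M b c + M e a * M a b * M b c * M c d))"
  proof (intro arg_cong[of _ _ T] ext)
    fix a b c d e
    show "16 * (
      (1 + M a b) / 2 * ((1 + M b c) / 2) * ((1 + M c d) / 2) * ((1 + M d e) / 2) * ((1 + M e a) / 2) +
      (1 + M e d) / 2 * ((1 + M d c) / 2) * ((1 + M c b) / 2) * ((1 + M b a) / 2) * ((1 + M a e) / 2)) = 1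
      + (M a b * M b c + M b c * M c d + M c d * M d e + M d e * M e a + M e a * M a b)
      + (M a b * M c d + M b c * M d e + M c d * M e a + M d e * M a b + M e a * M b c)
      + (M a b * M b c * M c d * M d e + M b c * M c d * M d e * M e a + M c d * M d e * M e a * M a b
         + M d e * M e a * M a b * M b c + M e a * M a b * M b c * M c d)"
      unfolding skew[of e d] skew[of d c] skew[of c b] skew[of b a] skew[of a e]
      by (simp add: field_simps)
  qed
  also have "\<dots> = real (card (distinct_tuples V)) + 5 * P + 5 * Q"
    by (simp only: add one p2 p3 p4 p5 z1 z2 z3 z4 z5 q2 q3 q4 q5 P_def[symmetric] Q_def[symmetric])
  finally have "32 * C = real (card (distinct_tuples V)) + 5 * (P + Q)" by simp
  then show ?thesis unfolding C_def P_def Q_def add[symmetric] unfolding T_def .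
qed

section \<open>Scores of a Hamiltonian tournament on five vertices\<close>

lemma abs_M_le_1: "\<lbrakk>u \<in> V; v \<in> V\<rbrakk> \<Longrightarrow> \<bar>M u v\<bar> \<le> 1"
  by (cases "u = v") (use unit[of u v] in \<open>auto simp: power2_eq_1_iff\<close>)

text \<open>At each vertex the two arcs of the cycle contribute 1 and -1. Only two other entries
  remain, so every score lies between -2 and 2.\<close>

lemma sum_score_squares_le_20:
  assumes t: "(a, b, c, d, e) \<in> distinct_tuples V" and V: "card V = 5"
    and arcs: "M a b = 1" "M b c = 1" "M c d = 1" "M d e = 1" "M e a = 1"
  shows "S \<le> 20"
proof -
  have eq: "V = {a, b, c, d, e}"
    using t V fin by (intro card_subset_eq[symmetric]) (auto simp: distinct_tuples_def)
  have dist: "distinct [a, b, c, d, e]"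
    using t by (simp add: distinct_tuples_def)
  have opp: "M b a = -1" "M c b = -1" "M d c = -1" "M e d = -1" "M a e = -1"
    using arcs by (simp_all add: skew[of b a] skew[of c b] skew[of d c] skew[of e d] skew[of a e])
  have "\<bar>score v\<bar> \<le> 2" if "v \<in> V" for v
  proof -
    note bounds = abs_M_le_1[OF that, of a] abs_M_le_1[OF that, of b] abs_M_le_1[OF that, of c]
      abs_M_le_1[OF that, of d] abs_M_le_1[OF that, of e]
    have "score v = M v a + M v b + M v c + M v d + M v e"
      using dist unfolding score_def by (simp add: eq)
    with bounds that show ?thesis
      by (auto simp: eq arcs opp)
  qed
  then have "(score v)\<^sup>2 \<le> 4" if "v \<in> V" for v
    using that abs_le_square_iff[of "score v" 2] by simp
  then have "S \<le> (\<Sum>v\<in>V. 4)" by (intro sum_mono) auto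
  then show ?thesis using V by simp
qed

end

section \<open>Counting 5-cycles through tuples\<close>

definition cycle_tuples :: "'a pair_pre_digraph \<Rightarrow> ('a \<times> 'a \<times> 'a \<times> 'a \<times> 'a) set" where
  "cycle_tuples T = {(a, b, c, d, e) \<in> distinct_tuples (pverts T).
    {(a, b), (b, c), (c, d), (d, e), (e, a)} \<subseteq> parcs T}"

text \<open>Forgets the starting vertex, so all rotations of a tuple have the same image.\<close>

definition cycle_of_tuple :: "'a \<times> 'a \<times> 'a \<times> 'a \<times> 'a \<Rightarrow> 'a pair_pre_digraph" where
  "cycle_of_tuple = (\<lambda>(a, b, c, d, e).
    \<lparr>pverts = {a, b, c, d, e}, parcs = {(a, b), (b, c), (c, d), (d, e), (e, a)}\<rparr>)"

context tournament
begin

lemma directed_cycles_5D: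
  assumes "H \<in> directed_cycles T 5"
  obtains a b c d e where "(a, b, c, d, e) \<in> cycle_tuples T" "cycle_of_tuple (a, b, c, d, e) = H"
proof -
  from assms obtain p where H: "H = \<lparr>pverts = fst ` set p, parcs = set p\<rparr>"
    and p: "cycle p" "length p = 5"
    by (auto simp: directed_cycles_def)
  from p(2) obtain e1 e2 e3 e4 e5 where p5: "p = [e1, e2, e3, e4, e5]"
    by (auto simp: numeral_eq_Suc length_Suc_conv)
  \<comment> \<open>\<open>cycle_def\<close> requires distinctness of the visited vertices after the
    first one, hence the order starting with \<open>b\<close> and closing with
    \<open>a\<close>.\<close>
  obtain a b c d e where e: "e1 = (a, b)" "e2 = (b, c)" "e3 = (c, d)" "e4 = (d, e)" "e5 = (e, a)"
    and dist: "distinct [b, c, d, e, a]" and arcs: "set p \<subseteq> parcs T"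
    using p(1) unfolding cycle_def p5 by (cases e1; cases e2; cases e3; cases e4; cases e5) (auto simp: awalk_def)
  have "{a, b, c, d, e} \<subseteq> pverts T"
    using arcs arc_fst_in_verts unfolding p5 e by fastforce
  with dist arcs have "(a, b, c, d, e) \<in> cycle_tuples T"
    by (auto simp: cycle_tuples_def distinct_tuples_def p5 e)
  moreover have "cycle_of_tuple (a, b, c, d, e) = H"
    by (auto simp: cycle_of_tuple_def H p5 e)
  ultimately show thesis by (rule that)
qed

lemma finite_cycle_tuples: "finite (cycle_tuples T)"
  by (rule finite_subset[OF _ finite_distinct_tuples[OF pair_finite_verts]]) (auto simp: cycle_tuples_def)

text \<open>The fibres of \<open>cycle_of_tuple\<close> are disjoint, and the fibre over a 5-cycle
  contains the five rotations of any tuple in it, which differ in their first vertex.\<close>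

lemma cycle_count_5_le: "5 * cycle_count T 5 \<le> card (cycle_tuples T)"
proof -
  let ?F = "\<lambda>H. {t \<in> cycle_tuples T. cycle_of_tuple t = H}"
  have sub: "directed_cycles T 5 \<subseteq> cycle_of_tuple ` cycle_tuples T"
    by (auto elim!: directed_cycles_5D)
  then have fin: "finite (directed_cycles T 5)"
    using finite_cycle_tuples finite_surj by blast
  have "5 * cycle_count T 5 = (\<Sum>H\<in>directed_cycles T 5. 5)"
    by (simp add: cycle_count_def)
  also have "\<dots> \<le> (\<Sum>H\<in>directed_cycles T 5. card (?F H))"
  proof (rule sum_mono)
    fix H assume "H \<in> directed_cycles T 5"
    then obtain a b c d e where t: "(a, b, c, d, e) \<in> cycle_tuples T" and H: "cycle_of_tuple (a, b, c, d, e) = H"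
      by (rule directed_cycles_5D)
    let ?R = "{(a, b, c, d, e), (b, c, d, e, a), (c, d, e, a, b), (d, e, a, b, c), (e, a, b, c, d)}"
    have "?R \<subseteq> ?F H"
      using t by (auto simp: cycle_tuples_def distinct_tuples_def cycle_of_tuple_def simp flip: H)
    moreover have "card ?R = 5"
      using t by (auto simp: cycle_tuples_def distinct_tuples_def)
    ultimately show "5 \<le> card (?F H)"
      using card_mono[of "?F H" ?R] finite_cycle_tuples by simp
  qed
  also have "\<dots> = card (\<Union>H\<in>directed_cycles T 5. ?F H)"
    using fin finite_cycle_tuples by (subst card_UN_disjoint) auto
  also have "\<dots> \<le> card (cycle_tuples T)"
    by (rule card_mono[OF finite_cycle_tuples]) auto
  finally show ?thesis .
qed

section \<open>The sign matrix of a tournament and the final count\<close>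

definition sign :: "'a \<Rightarrow> 'a \<Rightarrow> real" where
  "sign u v = of_bool ((u, v) \<in> parcs T) - of_bool ((v, u) \<in> parcs T)"

text \<open>A difference of two mirrored indicators is skew for all arguments; on distinct vertices
  exactly one of the indicators is 1.\<close>

lemma tournament_matrix_sign: "tournament_matrix (pverts T) sign"
proof
  show "finite (pverts T)" by (rule pair_finite_verts)
  show "sign u v = - sign v u" for u v by (simp add: sign_def)
  show "(sign u v)\<^sup>2 = 1" if "u \<in> pverts T" "v \<in> pverts T" "u \<noteq> v" for u v
    using exactly_one_arc[OF that] by (auto simp: sign_def)
qed

lemma of_bool_arc:
  "\<lbrakk>u \<in> pverts T; v \<in> pverts T; u \<noteq> v\<rbrakk> \<Longrightarrow> (1 + sign u v) / 2 = of_bool ((u, v) \<in> parcs T)"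
  using exactly_one_arc[of u v] by (auto simp: sign_def)

text \<open>On distinct vertices each factor is the indicator of an arc, so the product is the
  indicator of \<open>cycle_tuples T\<close>.\<close>

lemma card_cycle_tuples:
  "real (card (cycle_tuples T)) = (\<Sum>(a, b, c, d, e)\<in>distinct_tuples (pverts T).
    (1 + sign a b) / 2 * ((1 + sign b c) / 2) * ((1 + sign c d) / 2) * ((1 + sign d e) / 2) * ((1 + sign e a) / 2))"
proof -
  have "real (card (cycle_tuples T)) = (\<Sum>t\<in>distinct_tuples (pverts T). of_bool (t \<in> cycle_tuples T))"
    using finite_distinct_tuples[OF pair_finite_verts]
    by (subst sum_of_bool_eq) (auto simp: cycle_tuples_def intro!: arg_cong[of _ _ card])
  also have "\<dots> = (\<Sum>(a, b, c, d, e)\<in>distinct_tuples (pverts T).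
    (1 + sign a b) / 2 * ((1 + sign b c) / 2) * ((1 + sign c d) / 2) * ((1 + sign d e) / 2) * ((1 + sign e a) / 2))"
    by (intro sum.cong refl, clarify, subst (1 2 3 4 5) of_bool_arc)
      (auto simp: distinct_tuples_def cycle_tuples_def)
  finally show ?thesis .
qed

text \<open>A tuple in \<open>cycle_tuples T\<close> forces at least five vertices, and with exactly
  five it is a Hamiltonian cycle, which bounds the scores.\<close>

lemma card_cycle_tuples_le:
  defines "n \<equiv> real (card (pverts T))"
  shows "32 * real (card (cycle_tuples T)) \<le>
    n * (n - 1) * (n - 2) * (n - 3) * (n - 4) + 5 * (n * (n - 1) * (n - 2)\<^sup>2)"
proof -
  interpret M: tournament_matrix "pverts T" sign by (rule tournament_matrix_sign)
  let ?N = "card (pverts T)"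
  show ?thesis
  proof (cases "cycle_tuples T = {}")
    case True
    \<comment> \<open>Both summands on the right are nonnegative because their factors count tuples
      and pairs.\<close>
    have "n * (n - 1) * (n - 2) * (n - 3) * (n - 4) \<ge> 0"
      unfolding n_def M.card_distinct_tuples[symmetric] by simp
    moreover have "n * (n - 1) \<ge> 0"
      unfolding n_def of_nat_2_mult_choose[symmetric] by simp
    ultimately show ?thesis using True by simp
  next
    case False
    then obtain a b c d e where t: "(a, b, c, d, e) \<in> cycle_tuples T" by (metis ex_in_conv surj_pair)
    then have D: "(a, b, c, d, e) \<in> distinct_tuples (pverts T)" by (simp add: cycle_tuples_def)
    have "card {a, b, c, d, e} \<le> ?N"
      using D pair_finite_verts by (intro card_mono) (auto simp: distinct_tuples_def)
    then have "5 \<le> ?N" using D by (auto simp: distinct_tuples_def)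
    have "?N \<ge> 6 \<or> ?N = 5 \<and> M.S \<le> 20"
    proof (cases "?N = 5")
      case True
      have "sign u v = 1" if "(u, v) \<in> parcs T" for u v
        using that exactly_one_arc[of u v] arc_fst_in_verts[OF that] arc_snd_in_verts[OF that]
          pair_no_loops[OF that] by (simp add: sign_def)
      with t have "M.S \<le> 20"
        by (intro M.sum_score_squares_le_20[OF D True]) (auto simp: cycle_tuples_def)
      with True show ?thesis by simp
    qed (use \<open>5 \<le> ?N\<close> in simp)
    from M.path_cherry_sum_le_card[OF this] show ?thesis
      unfolding card_cycle_tuples M.cycle_indicator_sum M.card_distinct_tuples n_def by simp
  qed
qed

end

theorem corollary2p2:
  fixes T :: "'a pair_pre_digraph" and n :: nat
  assumes "tournament T" and "card (pverts T) = n"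
  shows "real (cycle_count T 5)
    \<le> 3 / 4 * real (n choose 5) + 1 / 4 * real (n choose 2) * ((real n - 2) / 2)\<^sup>2"
proof -
  interpret tournament T by fact
  \<comment> \<open>The factor 160 is 32 from the five halved indicators times 5 rotations; dividing
    by it turns 120 into 3/4 and 10 into 1/16.\<close>
  have "160 * real (cycle_count T 5) \<le> 32 * real (card (cycle_tuples T))"
    using cycle_count_5_le by simp
  also have "\<dots> \<le> real (n choose 5) * 120 + 5 * (real (n choose 2) * 2 * (real n - 2)\<^sup>2)"
    unfolding of_nat_5_mult_choose of_nat_2_mult_choose using card_cycle_tuples_le assms(2) by simp
  finally show ?thesis by (simp add: power_divide)
qed

end
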